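(* There is an absolute constant $c>0$ such that the following holds for every integer $N\ge 2$. (i) Given $\boldsymbol{y}\in\mathbb{R}^N$ and an L-CoLT matrix $M_L\in\mathcal{C}_L^N$ specified by its diagonal $\boldsymbol{\gamma}\in\mathbb{R}^N$ and its ratio vector $\boldsymbol{r}\in(\mathbb{R}\setminus\{0\})^{N-1}$, the product $M_L\boldsymbol{y}$ can be computed from $(\boldsymbol{\gamma},\boldsymbol{r},\boldsymbol{y})$ using at most $cN$ real arithmetic operations and $O(N)$ storage. (ii) Given $\boldsymbol{y}\in\mathbb{R}^N$ and a U-CoLT matrix $M_U\in\mathcal{C}_U^N$ specified by its superdiagonal $\boldsymbol{\gamma}'\in\mathbb{R}^{N-1}$ and its ratio vector $\boldsymbol{r}'\in(\mathbb{R}\setminus\{0\})^{N-2}$, the product $M_U\boldsymbol{y}$ can be computed from $(\boldsymbol{\gamma}',\boldsymbol{r}',\boldsymbol{y})$ using at most $cN$ real arithmetic operations and $O(N)$ storage. (iii) Consequently, if $M=M_L+M_U$ with $M_L\in\mathcal{C}_L^N$, $M_U\in\mathcal{C}_U^N$ specified in this way, then $M\boldsymbol{y}$ can be computed using $O(N)$ real arithmetic operations and $O(N)$ storage.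
   Context: An L-CoLT (lower-collinear triangular) matrix is an $M=[m_{i,j}]\in\mathbb{R}^{N\times N}$ with $m_{i,j}=0$ for $i<j$ such that there is a vector $\boldsymbol{r}\in(\mathbb{R}\setminus\{0\})^{N-1}$ (its ratio vector) with $m_{i+1,j}/m_{i,j}=r_i$ for all $1\le j\le i\le N-1$; the set of these is $\mathcal{C}_L^N$. Its entries are $m_{i,j}=\gamma_j\prod_{k=j}^{i-1}r_k$ for $j\le i$, where $\gamma_j=m_{j,j}$ (empty product $=1$). A U-CoLT (upper-collinear triangular) matrix is an $M=[m_{i,j}]\in\mathbb{R}^{N\times N}$ with $m_{i,j}=0$ for $i\ge j$ such that there is a vector $\boldsymbol{r}'\in(\mathbb{R}\setminus\{0\})^{N-2}$ (its ratio vector) with $m_{i-1,j}/m_{i,j}=r'_{i-1}$ for all $2\le i<j\le N$; the set of these is $\mathcal{C}_U^N$. Its entries are $m_{i,j}=\gamma'_{j-1}\prod_{k=i}^{j-2}r'_k$ for $i<j$, where $\gamma'_j=m_{j,j+1}$. Arithmetic operations are additions and multiplications of real numbers, in exact arithmetic. *)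

theory Defs
  imports "Jordan_Normal_Form.Matrix" "HOL-Library.Landau_Symbols"
begin

text \<open>Indices are 0-based throughout. The ratio conditions are written without division,
  so that zero entries on the (super)diagonal are covered; for nonzero entries this is
  the quotient form, see \<open>L_ratio_quotient\<close> and \<open>U_ratio_quotient\<close>.\<close>

definition L_ratio :: "nat \<Rightarrow> real vec \<Rightarrow> real mat \<Rightarrow> bool" where
  "L_ratio N r M \<longleftrightarrow> r \<in> carrier_vec (N - 1) \<and> (\<forall>i < N - 1. r $ i \<noteq> 0) \<and>
     (\<forall>i j. j \<le> i \<and> i + 1 < N \<longrightarrow> M $$ (i + 1, j) = r $ i * M $$ (i, j))"

definition L_CoLT :: "nat \<Rightarrow> real mat set" where
  "L_CoLT N = {M \<in> carrier_mat N N. (\<forall>i j. i < j \<and> j < N \<longrightarrow> M $$ (i, j) = 0) \<and>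
     (\<exists>r. L_ratio N r M)}"

definition L_specifies :: "nat \<Rightarrow> real vec \<Rightarrow> real vec \<Rightarrow> real mat \<Rightarrow> bool" where
  "L_specifies N \<gamma> r M \<longleftrightarrow> M \<in> L_CoLT N \<and> L_ratio N r M \<and> \<gamma> = vec N (\<lambda>j. M $$ (j, j))"

definition U_ratio :: "nat \<Rightarrow> real vec \<Rightarrow> real mat \<Rightarrow> bool" where
  "U_ratio N r M \<longleftrightarrow> r \<in> carrier_vec (N - 2) \<and> (\<forall>i < N - 2. r $ i \<noteq> 0) \<and>
     (\<forall>i j. i + 1 < j \<and> j < N \<longrightarrow> M $$ (i, j) = r $ i * M $$ (i + 1, j))"

definition U_CoLT :: "nat \<Rightarrow> real mat set" where
  "U_CoLT N = {M \<in> carrier_mat N N. (\<forall>i j. j \<le> i \<and> i < N \<longrightarrow> M $$ (i, j) = 0) \<and>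
     (\<exists>r. U_ratio N r M)}"

definition U_specifies :: "nat \<Rightarrow> real vec \<Rightarrow> real vec \<Rightarrow> real mat \<Rightarrow> bool" where
  "U_specifies N \<gamma> r M \<longleftrightarrow> M \<in> U_CoLT N \<and> U_ratio N r M \<and>
     \<gamma> = vec (N - 1) (\<lambda>j. M $$ (j, j + 1))"

lemma L_ratio_quotient:
  assumes "\<And>i j. j \<le> i \<Longrightarrow> i + 1 < N \<Longrightarrow> M $$ (i, j) \<noteq> 0"
  shows "L_ratio N r M \<longleftrightarrow> r \<in> carrier_vec (N - 1) \<and> (\<forall>i < N - 1. r $ i \<noteq> 0) \<and>
     (\<forall>i j. j \<le> i \<and> i + 1 < N \<longrightarrow> M $$ (i + 1, j) / M $$ (i, j) = r $ i)"
proof -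
  have "M $$ (i + 1, j) / M $$ (i, j) = r $ i \<longleftrightarrow> M $$ (i + 1, j) = r $ i * M $$ (i, j)"
    if "j \<le> i" "i + 1 < N" for i j
    using assms[OF that] by (simp add: divide_eq_eq)
  then show ?thesis unfolding L_ratio_def by blast
qed

lemma U_ratio_quotient:
  assumes "\<And>i j. i + 1 < j \<Longrightarrow> j < N \<Longrightarrow> M $$ (i + 1, j) \<noteq> 0"
  shows "U_ratio N r M \<longleftrightarrow> r \<in> carrier_vec (N - 2) \<and> (\<forall>i < N - 2. r $ i \<noteq> 0) \<and>
     (\<forall>i j. i + 1 < j \<and> j < N \<longrightarrow> M $$ (i, j) / M $$ (i + 1, j) = r $ i)"
proof -
  have "M $$ (i, j) / M $$ (i + 1, j) = r $ i \<longleftrightarrow> M $$ (i, j) = r $ i * M $$ (i + 1, j)"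
    if "i + 1 < j" "j < N" for i j
    using assms[OF that] by (simp add: divide_eq_eq)
  then show ?thesis unfolding U_ratio_def by blast
qed

lemma L_entries:
  assumes "L_specifies N \<gamma> r M" "j \<le> i" "i < N"
  shows "M $$ (i, j) = \<gamma> $ j * (\<Prod>k = j..<i. r $ k)"
  using assms(2,3)
proof (induction i rule: dec_induct)
  case base
  then show ?case using assms(1) by (simp add: L_specifies_def)
next
  case (step i)
  then have "M $$ (Suc i, j) = r $ i * M $$ (i, j)"
    using assms(1) by (simp add: L_specifies_def L_ratio_def)
  then show ?case using step by simp
qed

lemma U_entries:
  assumes "U_specifies N \<gamma> r M" "i < j" "j < N"
  shows "M $$ (i, j) = \<gamma> $ (j - 1) * (\<Prod>k = i..<j - 1. r $ k)"
proof -
  have "i \<le> j - 1" using assms by simp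
  then show ?thesis
  proof (induction i rule: inc_induct)
    case base
    then show ?case using assms by (cases j) (simp_all add: U_specifies_def)
  next
    case (step i)
    then have "M $$ (i, j) = r $ i * M $$ (Suc i, j)"
      using assms by (simp add: U_specifies_def U_ratio_def)
    then show ?case using step by (simp add: prod.atLeast_Suc_lessThan)
  qed
qed

text \<open>The cost model is that of straight-line programs. \<open>Add d a b\<close> and \<open>Mul d a b\<close>
  write the sum, respectively the product, of cells \<open>a\<close> and \<open>b\<close> into cell \<open>d\<close>; every
  instruction is one arithmetic operation, and there are no constants, tests or copies.
  The input occupies the first cells, the remaining ones start at 0, and the result is
  found in pairwise distinct output cells. Storage is the total number of cells, input and
  output included.\<close>

datatype instr = Add nat nat nat | Mul nat nat nat

fun step :: "instr \<Rightarrow> real list \<Rightarrow> real list" where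
  "step (Add d a b) m = m[d := m ! a + m ! b]"
| "step (Mul d a b) m = m[d := m ! a * m ! b]"

fun addresses :: "instr \<Rightarrow> nat set" where
  "addresses (Add d a b) = {d, a, b}"
| "addresses (Mul d a b) = {d, a, b}"

datatype slp = SLP (instrs: "instr list") (storage: nat) (out_cells: "nat list")

definition arith_ops :: "slp \<Rightarrow> nat" where
  "arith_ops P = length (instrs P)"

definition slp_result :: "slp \<Rightarrow> real list \<Rightarrow> real list" where
  "slp_result P xs =
     (let m = fold step (instrs P) (xs @ replicate (storage P - length xs) 0)
      in map (\<lambda>k. m ! k) (out_cells P))"

definition slp_wf :: "nat \<Rightarrow> slp \<Rightarrow> bool" where
  "slp_wf n P \<longleftrightarrow> n \<le> storage P \<and> (\<forall>I \<in> set (instrs P). addresses I \<subseteq> {..<storage P}) \<and>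
     distinct (out_cells P) \<and> set (out_cells P) \<subseteq> {..<storage P}"

definition computes :: "slp \<Rightarrow> real vec list \<Rightarrow> real vec \<Rightarrow> bool" where
  "computes P vs w \<longleftrightarrow>
     (let xs = concat (map list_of_vec vs)
      in slp_wf (length xs) P \<and> slp_result P xs = list_of_vec w)"

end

theory Submission
  imports Defs
begin

text \<open>Collinearity of the columns turns the rows of the product into a first-order linear
  recurrence: \<open>(M\<^sub>L y)\<^sub>i\<^sub>+\<^sub>1 = r\<^sub>i (M\<^sub>L y)\<^sub>i + \<gamma>\<^sub>i\<^sub>+\<^sub>1 y\<^sub>i\<^sub>+\<^sub>1\<close> going down, and
  \<open>(M\<^sub>U y)\<^sub>i = r'\<^sub>i (M\<^sub>U y)\<^sub>i\<^sub>+\<^sub>1 + \<gamma>'\<^sub>i y\<^sub>i\<^sub>+\<^sub>1\<close> going up from the last row, which is zero.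
  Each step costs two multiplications and one addition.\<close>

section \<open>Row recurrences of the two matrix-vector products\<close>

lemma mult_mat_vec_index_sum:
  fixes M :: "'a :: comm_semiring_0 mat"
  assumes "M \<in> carrier_mat n k" "y \<in> carrier_vec k" "i < n"
  shows "(M *\<^sub>v y) $ i = (\<Sum>j<k. M $$ (i, j) * y $ j)"
  using assms by (simp add: scalar_prod_def lessThan_atLeast0)

lemma L_specifies_dims:
  assumes "L_specifies N \<gamma> r M"
  shows "M \<in> carrier_mat N N" "dim_vec \<gamma> = N" "dim_vec r = N - 1"
  using assms by (auto simp: L_specifies_def L_CoLT_def L_ratio_def)

lemma U_specifies_dims:
  assumes "U_specifies N \<gamma> r M"
  shows "M \<in> carrier_mat N N" "dim_vec \<gamma> = N - 1" "dim_vec r = N - 2"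
  using assms by (auto simp: U_specifies_def U_CoLT_def U_ratio_def)

lemma L_mult_first:
  assumes M: "L_specifies N \<gamma> r M" and y: "y \<in> carrier_vec N" and N: "0 < N"
  shows "(M *\<^sub>v y) $ 0 = \<gamma> $ 0 * y $ 0"
proof -
  have "M $$ (0, j) * y $ j = (if j = 0 then \<gamma> $ 0 * y $ 0 else 0)" if "j < N" for j
    using M that by (auto simp: L_specifies_def L_CoLT_def)
  then show ?thesis
    using N by (simp add: mult_mat_vec_index_sum[OF L_specifies_dims(1)[OF M] y N])
qed

text \<open>Rows \<open>i\<close> and \<open>Suc i\<close> are compared column by column: columns up
  to \<open>i\<close> scale by \<open>r $ i\<close>, column \<open>Suc i\<close> brings a fresh term
  because row \<open>i\<close> vanishes there, and later columns are zero in both rows.\<close>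

lemma L_mult_Suc:
  assumes M: "L_specifies N \<gamma> r M" and y: "y \<in> carrier_vec N" and i: "Suc i < N"
  shows "(M *\<^sub>v y) $ Suc i = r $ i * (M *\<^sub>v y) $ i + \<gamma> $ Suc i * y $ Suc i"
proof -
  have zero: "M $$ (k, j) = 0" if "k < j" "j < N" for k j
    using M that by (simp add: L_specifies_def L_CoLT_def)
  have ratio: "M $$ (Suc i, j) = r $ i * M $$ (i, j)" if "j \<le> i" for j
    using M i that by (simp add: L_specifies_def L_ratio_def)
  have diag: "M $$ (Suc i, Suc i) = \<gamma> $ Suc i"
    using M i by (simp add: L_specifies_def)
  have "M $$ (Suc i, j) * y $ j =
      r $ i * (M $$ (i, j) * y $ j) + (if j = Suc i then \<gamma> $ Suc i * y $ Suc i else 0)"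
    if "j < N" for j
  proof -
    consider "j \<le> i" | "j = Suc i" | "Suc i < j" by linarith
    then show ?thesis using that i by cases (simp_all add: zero ratio diag)
  qed
  then show ?thesis
    using i by (simp add: mult_mat_vec_index_sum[OF L_specifies_dims(1)[OF M] y]
        sum.distrib flip: sum_distrib_left)
qed

lemma U_mult_last:
  assumes M: "U_specifies N \<gamma> r M" and y: "y \<in> carrier_vec N" and N: "0 < N"
  shows "(M *\<^sub>v y) $ (N - 1) = 0"
proof -
  have "M $$ (N - 1, j) = 0" if "j < N" for j
    using M that by (auto simp: U_specifies_def U_CoLT_def)
  then show ?thesis
    using N by (simp add: mult_mat_vec_index_sum[OF U_specifies_dims(1)[OF M] y])
qed

text \<open>In the penultimate row the factor \<open>c\<close> is arbitrary, because it multiplies the zero last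
  row; this lets a program read any cell there instead of treating that row separately.\<close>

lemma U_mult_step:
  assumes M: "U_specifies N \<gamma> r M" and y: "y \<in> carrier_vec N" and i: "Suc i < N"
    and c: "i < N - 2 \<Longrightarrow> c = r $ i"
  shows "(M *\<^sub>v y) $ i = c * (M *\<^sub>v y) $ Suc i + \<gamma> $ i * y $ Suc i"
proof -
  have zero: "M $$ (k, j) = 0" if "j \<le> k" "k < N" for k j
    using M that by (simp add: U_specifies_def U_CoLT_def)
  \<comment> \<open>A column beyond \<open>Suc i\<close> exists only if \<open>i < N - 2\<close>,
    exactly where \<open>c\<close> is tied to \<open>r $ i\<close>.\<close>
  have ratio: "M $$ (i, j) = c * M $$ (Suc i, j)" if "Suc i < j" "j < N" for j
    using M c that by (simp add: U_specifies_def U_ratio_def)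
  have diag: "M $$ (i, Suc i) = \<gamma> $ i"
    using M i by (simp add: U_specifies_def)
  have "M $$ (i, j) * y $ j =
      c * (M $$ (Suc i, j) * y $ j) + (if j = Suc i then \<gamma> $ i * y $ Suc i else 0)"
    if "j < N" for j
  proof -
    consider "j \<le> i" | "j = Suc i" | "Suc i < j" by linarith
    then show ?thesis using that i by cases (simp_all add: zero ratio diag)
  qed
  then show ?thesis
    using i by (simp add: mult_mat_vec_index_sum[OF U_specifies_dims(1)[OF M] y]
        sum.distrib flip: sum_distrib_left)
qed

section \<open>Straight-line programs for recurrences and sums\<close>

text \<open>Evaluates \<open>v (k + 1) = x k * v k + a k * b k\<close> for \<open>k < n\<close>, with \<open>v k\<close> in cell \<open>C + k\<close>
  and \<open>t\<close> as scratch cell. Starting from \<open>v 0 = 0\<close> makes \<open>x 0\<close> irrelevant.\<close>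

definition recurrence_prog ::
  "nat \<Rightarrow> nat \<Rightarrow> (nat \<Rightarrow> nat) \<Rightarrow> (nat \<Rightarrow> nat) \<Rightarrow> (nat \<Rightarrow> nat) \<Rightarrow> nat \<Rightarrow> instr list" where
  "recurrence_prog t C x a b n = concat (map (\<lambda>k.
     [Mul t (a k) (b k), Mul (C + Suc k) (x k) (C + k), Add (C + Suc k) (C + Suc k) t]) [0..<n])"

lemma recurrence_prog_Suc:
  "recurrence_prog t C x a b (Suc n) = recurrence_prog t C x a b n @
     [Mul t (a n) (b n), Mul (C + Suc n) (x n) (C + n), Add (C + Suc n) (C + Suc n) t]"
  by (simp add: recurrence_prog_def)

lemma length_recurrence_prog [simp]: "length (recurrence_prog t C x a b n) = 3 * n"
  by (induction n) (simp_all add: recurrence_prog_def)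

lemma addresses_recurrence_prog:
  assumes "t < C" "C + n < S" "\<And>k. k < n \<Longrightarrow> x k < C \<and> a k < C \<and> b k < C"
    and "I \<in> set (recurrence_prog t C x a b n)"
  shows "addresses I \<subseteq> {..<S}"
proof -
  from assms(4) obtain k where k: "k < n"
    and I: "I \<in> {Mul t (a k) (b k), Mul (C + Suc k) (x k) (C + k), Add (C + Suc k) (C + Suc k) t}"
    by (auto simp: recurrence_prog_def)
  show ?thesis using I assms(1,2) assms(3)[OF k] k by auto
qed

text \<open>Induction on the number of rounds. Operand cells lie below the block and differ from
  \<open>t\<close>, so they keep their initial contents and the recurrence can be stated over
  \<open>m\<close>. The claim about unchanged cells lets further programs run afterwards.\<close>

lemma fold_recurrence_prog:
  assumes "t < C" "C + n < length m" "m ! C = 0" "v 0 = 0"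
    and "\<And>k. k < n \<Longrightarrow> x k < C \<and> a k < C \<and> b k < C \<and> x k \<noteq> t \<and> a k \<noteq> t \<and> b k \<noteq> t"
    and "\<And>k. k < n \<Longrightarrow> v (Suc k) = m ! x k * v k + m ! a k * m ! b k"
  defines "m' \<equiv> fold step (recurrence_prog t C x a b n) m"
  shows "length m' = length m \<and> (\<forall>k \<le> n. m' ! (C + k) = v k) \<and>
    (\<forall>j. j < C \<and> j \<noteq> t \<or> C + n < j \<longrightarrow> m' ! j = m ! j)"
  using assms(2,5,6) unfolding m'_def
proof (induction n)
  case 0
  then show ?case using assms(3,4) by (simp add: recurrence_prog_def)
next
  case (Suc n)
  let ?m = "fold step (recurrence_prog t C x a b n) m"
  have IH: "length ?m = length m" "\<And>k. k \<le> n \<Longrightarrow> ?m ! (C + k) = v k"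
    "\<And>j. j < C \<and> j \<noteq> t \<or> C + n < j \<Longrightarrow> ?m ! j = m ! j"
    using Suc by auto
  have cells: "x n < C" "a n < C" "b n < C" "x n \<noteq> t" "a n \<noteq> t" "b n \<noteq> t"
    using Suc.prems(2)[of n] by simp_all
  \<comment> \<open>The bare product in cell \<open>C + Suc n\<close> is overwritten at once, so a
    whole round amounts to two updates.\<close>
  have result: "fold step (recurrence_prog t C x a b (Suc n)) m =
      (?m[t := m ! a n * m ! b n])[C + Suc n := v (Suc n)]"
    using Suc.prems(1,3) assms(1) cells
    by (simp add: recurrence_prog_Suc IH list_update_swap[of t])
  show ?case unfolding result
    using Suc.prems(1) assms(1) IH by (auto simp: nth_list_update le_Suc_eq)
qed

definition add_prog :: "nat \<Rightarrow> (nat \<Rightarrow> nat) \<Rightarrow> nat \<Rightarrow> instr list" where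
  "add_prog D e n = map (\<lambda>k. Add (D + k) (D + k) (e k)) [0..<n]"

lemma add_prog_Suc: "add_prog D e (Suc n) = add_prog D e n @ [Add (D + n) (D + n) (e n)]"
  by (simp add: add_prog_def)

text \<open>The second summands are read from above the block being updated, so no write disturbs a
  later read.\<close>

lemma fold_add_prog:
  assumes "D + n \<le> length m" "\<And>k. k < n \<Longrightarrow> D + n \<le> e k"
  defines "m' \<equiv> fold step (add_prog D e n) m"
  shows "length m' = length m \<and> (\<forall>k < n. m' ! (D + k) = m ! (D + k) + m ! e k) \<and>
    (\<forall>j \<ge> D + n. m' ! j = m ! j)"
  using assms(1,2) unfolding m'_def
proof (induction n)
  case 0
  then show ?case by (simp add: add_prog_def)
next
  case (Suc n)
  let ?m = "fold step (add_prog D e n) m"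
  have e: "D + n \<le> e k" if "k < Suc n" for k using Suc.prems(2)[OF that] by simp
  have IH: "length ?m = length m" "\<And>k. k < n \<Longrightarrow> ?m ! (D + k) = m ! (D + k) + m ! e k"
    "\<And>j. D + n \<le> j \<Longrightarrow> ?m ! j = m ! j"
    using Suc.IH Suc.prems(1) e by simp_all
  have result: "fold step (add_prog D e (Suc n)) m = ?m[D + n := m ! (D + n) + m ! e n]"
    using e by (simp add: add_prog_Suc IH)
  show ?case unfolding result
    using Suc.prems(1) IH by (auto simp: nth_list_update less_Suc_eq)
qed

section \<open>Input blocks, programs and memory layouts\<close>

lemma list_of_vec_eq_mapI:
  assumes "dim_vec w = n" "length ks = n" "\<And>i. i < n \<Longrightarrow> f (ks ! i) = w $ i"
  shows "map f ks = list_of_vec w"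
  using assms by (intro nth_equalityI) (simp_all add: list_of_vec_index)

text \<open>Serves to read input entries: \<open>us\<close> collects the vectors stored before
  \<open>v\<close>, and \<open>ws\<close> the later ones with the zero padding.\<close>

lemma nth_list_of_vec_block:
  assumes "m = us @ list_of_vec v @ ws" "k = length us + i" "i < dim_vec v"
  shows "m ! k = v $ i"
  using assms by (simp add: nth_append list_of_vec_index)

text \<open>Cell layout: the input vectors in order, then the scratch cell, then one block
  per recurrence. The cell named as \<open>x 0\<close> need not belong to the ratio vector. The upper
  recurrence fills its block from the last row to the first, hence the reversed indices.\<close>

definition L_slp :: "nat \<Rightarrow> slp" where
  "L_slp N = SLP
     (recurrence_prog (3 * N - 1) (3 * N) (\<lambda>k. N + k - 1) (\<lambda>k. k) (\<lambda>k. 2 * N - 1 + k) N)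
     (4 * N + 1) [3 * N + 1..<4 * N + 1]"

definition U_slp :: "nat \<Rightarrow> slp" where
  "U_slp N = SLP
     (recurrence_prog (3 * N - 3) (3 * N - 2) (\<lambda>k. N - 1 + (N - 2 - k)) (\<lambda>k. N - 2 - k)
       (\<lambda>k. 2 * N - 3 + (N - 1 - k)) (N - 1))
     (4 * N - 2) (rev [3 * N - 2..<4 * N - 2])"

text \<open>Both recurrences share one scratch cell. The first block starts with an auxiliary zero
  in cell \<open>5 * N - 3\<close>, so its rows begin at \<open>5 * N - 2\<close>; the second
  product is added onto them in place, its bottom-up block being read backwards.\<close>

definition LU_slp :: "nat \<Rightarrow> slp" where
  "LU_slp N = SLP
     (recurrence_prog (5 * N - 4) (5 * N - 3) (\<lambda>k. N + k - 1) (\<lambda>k. k) (\<lambda>k. 4 * N - 4 + k) N @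
      recurrence_prog (5 * N - 4) (6 * N - 2) (\<lambda>k. 3 * N - 2 + (N - 2 - k))
       (\<lambda>k. 2 * N - 1 + (N - 2 - k)) (\<lambda>k. 4 * N - 4 + (N - 1 - k)) (N - 1) @
      add_prog (5 * N - 2) (\<lambda>k. 6 * N - 2 + (N - 1 - k)) N)
     (7 * N - 2) [5 * N - 2..<6 * N - 2]"

section \<open>Correctness of the three programs\<close>

text \<open>An artificial zero row placed before row 0 brings the first row under the same
  recurrence. Rows are thereby shifted by one, and \<open>c\<close> is free at \<open>k = 0\<close>
  since it multiplies that zero.\<close>

lemma L_recurrence:
  assumes M: "L_specifies N \<gamma> r M" and y: "y \<in> carrier_vec N" and k: "k < N"
    and c: "0 < k \<Longrightarrow> c = r $ (k - 1)"
  defines "v \<equiv> case_nat 0 (\<lambda>i. (M *\<^sub>v y) $ i)"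
  shows "v (Suc k) = c * v k + \<gamma> $ k * y $ k"
  using L_mult_first[OF M y] L_mult_Suc[OF M y] k c by (cases k) (simp_all add: v_def)

text \<open>Rows are counted from the bottom. The last row is itself zero and serves as starting
  value, so \<open>N - 1\<close> rounds suffice without an artificial row; the freedom of
  \<open>c\<close> at \<open>k = 0\<close> is that of the penultimate row in
  \<open>U_mult_step\<close>.\<close>

lemma U_recurrence:
  assumes M: "U_specifies N \<gamma> r M" and y: "y \<in> carrier_vec N" and k: "k < N - 1"
    and c: "0 < k \<Longrightarrow> c = r $ (N - 2 - k)"
  defines "v \<equiv> \<lambda>k. (M *\<^sub>v y) $ (N - 1 - k)"
  shows "v (Suc k) = c * v k + \<gamma> $ (N - 2 - k) * y $ (N - 1 - k)"
proof -
  have eq: "N - 1 - k = Suc (N - 2 - k)" "N - 1 - Suc k = N - 2 - k" using k by simp_all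
  show ?thesis unfolding v_def eq using k c by (intro U_mult_step[OF M y]) auto
qed

lemma computes_L_slp:
  assumes N: "2 \<le> N" and M: "L_specifies N \<gamma> r M" and y: "y \<in> carrier_vec N"
  shows "computes (L_slp N) [\<gamma>, r, y] (M *\<^sub>v y)"
proof -
  define xs where "xs = list_of_vec \<gamma> @ list_of_vec r @ list_of_vec y"
  define m where "m = xs @ replicate (4 * N + 1 - length xs) 0"
  define v where "v = case_nat 0 (\<lambda>i. (M *\<^sub>v y) $ i)"
  let ?p = "recurrence_prog (3 * N - 1) (3 * N) (\<lambda>k. N + k - 1) (\<lambda>k. k) (\<lambda>k. 2 * N - 1 + k) N"
  note dims = L_specifies_dims[OF M] carrier_vecD[OF y]
  have len: "length xs = 3 * N - 1" using dims N by (simp add: xs_def)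
  have cell_\<gamma>: "m ! k = \<gamma> $ k" if "k < N" for k
    by (rule nth_list_of_vec_block[where us = "[]"])
      (use that N dims in \<open>auto simp: m_def xs_def\<close>)
  have cell_y: "m ! (2 * N - 1 + k) = y $ k" if "k < N" for k
    by (rule nth_list_of_vec_block[where us = "list_of_vec \<gamma> @ list_of_vec r"])
      (use that N dims in \<open>auto simp: m_def xs_def\<close>)
  \<comment> \<open>Positive \<open>k\<close> only: for \<open>k = 0\<close> the address
    \<open>N - 1\<close> holds the last entry of \<open>\<gamma>\<close>.\<close>
  have cell_r: "m ! (N + k - 1) = r $ (k - 1)" if "0 < k" "k < N" for k
    by (rule nth_list_of_vec_block[where us = "list_of_vec \<gamma>"])
      (use that N dims in \<open>auto simp: m_def xs_def\<close>)
  have "length (fold step ?p m) = length m \<and> (\<forall>k\<le>N. fold step ?p m ! (3 * N + k) = v k) \<and>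
    (\<forall>j. j < 3 * N \<and> j \<noteq> 3 * N - 1 \<or> 3 * N + N < j \<longrightarrow> fold step ?p m ! j = m ! j)"
  proof (rule fold_recurrence_prog)
    show "v (Suc k) = m ! (N + k - 1) * v k + m ! k * m ! (2 * N - 1 + k)" if "k < N" for k
      unfolding v_def cell_\<gamma>[OF that] cell_y[OF that]
      by (intro L_recurrence[OF M y that] cell_r[OF _ that])
    show "m ! (3 * N) = 0" using len N by (simp add: m_def nth_append)
  qed (use N len in \<open>auto simp: v_def m_def\<close>)
  \<comment> \<open>Cell \<open>3 * N\<close> holds the artificial zero row, so row \<open>i\<close>
    sits at offset \<open>Suc i\<close>.\<close>
  then have "fold step ?p m ! (3 * N + Suc i) = (M *\<^sub>v y) $ i" if "i < N" for i
    using that by (simp add: v_def del: add_Suc_right)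
  then have "map (\<lambda>k. fold step ?p m ! k) [3 * N + 1..<4 * N + 1] = list_of_vec (M *\<^sub>v y)"
    using dims by (intro list_of_vec_eq_mapI[of _ N]) (simp_all del: upt_Suc)
  moreover have "slp_wf (3 * N - 1) (L_slp N)"
  proof -
    have "addresses I \<subseteq> {..<4 * N + 1}" if "I \<in> set ?p" for I
      using N by (intro addresses_recurrence_prog[OF _ _ _ that]) auto
    then show ?thesis using N by (force simp: slp_wf_def L_slp_def simp del: upt_Suc)
  qed
  ultimately show ?thesis
    by (simp add: computes_def slp_result_def L_slp_def len m_def flip: xs_def)
qed

lemma computes_U_slp:
  assumes N: "2 \<le> N" and M: "U_specifies N \<gamma> r M" and y: "y \<in> carrier_vec N"
  shows "computes (U_slp N) [\<gamma>, r, y] (M *\<^sub>v y)"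
proof -
  define xs where "xs = list_of_vec \<gamma> @ list_of_vec r @ list_of_vec y"
  define m where "m = xs @ replicate (4 * N - 2 - length xs) 0"
  define v where "v = (\<lambda>k. (M *\<^sub>v y) $ (N - 1 - k))"
  let ?x = "\<lambda>k. N - 1 + (N - 2 - k)" and ?a = "\<lambda>k. N - 2 - k"
    and ?b = "\<lambda>k. 2 * N - 3 + (N - 1 - k)"
  let ?p = "recurrence_prog (3 * N - 3) (3 * N - 2) ?x ?a ?b (N - 1)"
  note dims = U_specifies_dims[OF M] carrier_vecD[OF y]
  have len: "length xs = 3 * N - 3" using dims N by (simp add: xs_def)
  have cell_\<gamma>: "m ! ?a k = \<gamma> $ (N - 2 - k)" if "k < N - 1" for k
    by (rule nth_list_of_vec_block[where us = "[]"])
      (use that N dims in \<open>auto simp: m_def xs_def\<close>)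
  have cell_y: "m ! ?b k = y $ (N - 1 - k)" if "k < N - 1" for k
    by (rule nth_list_of_vec_block[where us = "list_of_vec \<gamma> @ list_of_vec r"])
      (use that N dims in \<open>auto simp: m_def xs_def\<close>)
  \<comment> \<open>For \<open>k = 0\<close> the address \<open>2 * N - 3\<close> is the first cell
    of \<open>y\<close>; if \<open>N = 2\<close>, the ratio vector is empty and so is this range of
    \<open>k\<close>.\<close>
  have cell_r: "m ! ?x k = r $ (N - 2 - k)" if "0 < k" "k < N - 1" for k
    by (rule nth_list_of_vec_block[where us = "list_of_vec \<gamma>"])
      (use that N dims in \<open>auto simp: m_def xs_def\<close>)
  have p: "length (fold step ?p m) = length m \<and>
    (\<forall>k\<le>N - 1. fold step ?p m ! (3 * N - 2 + k) = v k) \<and>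
    (\<forall>j. j < 3 * N - 2 \<and> j \<noteq> 3 * N - 3 \<or> 3 * N - 2 + (N - 1) < j \<longrightarrow> fold step ?p m ! j = m ! j)"
  proof (rule fold_recurrence_prog)
    show "v (Suc k) = m ! ?x k * v k + m ! ?a k * m ! ?b k" if "k < N - 1" for k
      unfolding v_def cell_\<gamma>[OF that] cell_y[OF that]
      by (intro U_recurrence[OF M y that] cell_r[OF _ that])
    show "m ! (3 * N - 2) = 0" using len N by (simp add: m_def nth_append)
    show "v 0 = 0" using U_mult_last[OF M y] N by (simp add: v_def)
  qed (use N len in \<open>auto simp: m_def\<close>)
  have "map (\<lambda>k. fold step ?p m ! k) (rev [3 * N - 2..<4 * N - 2]) = list_of_vec (M *\<^sub>v y)"
  proof (rule list_of_vec_eq_mapI)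
    \<comment> \<open>Position \<open>i\<close> of the reversed range is offset
      \<open>N - 1 - i\<close> of the block, where the bottom-up order has put row
      \<open>i\<close>.\<close>
    fix i assume i: "i < N"
    then have "rev [3 * N - 2..<4 * N - 2] ! i = 3 * N - 2 + (N - 1 - i)"
      by (simp add: rev_nth)
    moreover have "fold step ?p m ! (3 * N - 2 + (N - 1 - i)) = v (N - 1 - i)"
      using p by (metis diff_le_self)
    moreover have "v (N - 1 - i) = (M *\<^sub>v y) $ i" using i by (simp add: v_def)
    ultimately show "fold step ?p m ! (rev [3 * N - 2..<4 * N - 2] ! i) = (M *\<^sub>v y) $ i"
      by (simp only:)
  qed (use dims N in auto)
  moreover have "slp_wf (3 * N - 3) (U_slp N)"
  proof -
    have "addresses I \<subseteq> {..<4 * N - 2}" if "I \<in> set ?p" for I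
      using N by (intro addresses_recurrence_prog[OF _ _ _ that]) auto
    then show ?thesis using N by (force simp: slp_wf_def U_slp_def)
  qed
  ultimately show ?thesis
    by (simp add: computes_def slp_result_def U_slp_def len m_def flip: xs_def)
qed

lemma computes_LU_slp:
  assumes N: "2 \<le> N" and A: "L_specifies N \<gamma> r A" and B: "U_specifies N \<gamma>' r' B"
    and y: "y \<in> carrier_vec N"
  shows "computes (LU_slp N) [\<gamma>, r, \<gamma>', r', y] ((A + B) *\<^sub>v y)"
proof -
  define xs where "xs = list_of_vec \<gamma> @ list_of_vec r @ list_of_vec \<gamma>' @ list_of_vec r' @ list_of_vec y"
  define m where "m = xs @ replicate (7 * N - 2 - length xs) 0"
  define v where "v = case_nat 0 (\<lambda>i. (A *\<^sub>v y) $ i)"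
  define w where "w = (\<lambda>k. (B *\<^sub>v y) $ (N - 1 - k))"
  let ?x = "\<lambda>k. N + k - 1" and ?b = "\<lambda>k. 4 * N - 4 + k"
  let ?x' = "\<lambda>k. 3 * N - 2 + (N - 2 - k)" and ?a' = "\<lambda>k. 2 * N - 1 + (N - 2 - k)"
    and ?b' = "\<lambda>k. 4 * N - 4 + (N - 1 - k)" and ?e = "\<lambda>k. 6 * N - 2 + (N - 1 - k)"
  let ?p = "recurrence_prog (5 * N - 4) (5 * N - 3) ?x (\<lambda>k. k) ?b N"
  let ?q = "recurrence_prog (5 * N - 4) (6 * N - 2) ?x' ?a' ?b' (N - 1)"
  let ?s = "add_prog (5 * N - 2) ?e N"
  define m1 where "m1 = fold step ?p m"
  define m2 where "m2 = fold step ?q m1"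
  define m3 where "m3 = fold step ?s m2"
  note dims = L_specifies_dims[OF A] U_specifies_dims[OF B] carrier_vecD[OF y]
  have len: "length xs = 5 * N - 4" using dims N by (simp add: xs_def)
  have len_m: "length m = 7 * N - 2" using len N by (simp add: m_def)
  have zero: "m ! k = 0" if "5 * N - 4 \<le> k" "k < 7 * N - 2" for k
    using len that by (simp add: m_def nth_append)
  have cell_\<gamma>: "m ! k = \<gamma> $ k" if "k < N" for k
    by (rule nth_list_of_vec_block[where us = "[]"])
      (use that N dims in \<open>auto simp: m_def xs_def\<close>)
  have cell_y: "m ! ?b k = y $ k" if "k < N" for k
    by (rule nth_list_of_vec_block[where us = "list_of_vec \<gamma> @ list_of_vec r @ list_of_vec \<gamma>' @ list_of_vec r'"])
      (use that N dims in \<open>auto simp: m_def xs_def\<close>)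
  have cell_r: "m ! ?x k = r $ (k - 1)" if "0 < k" "k < N" for k
    by (rule nth_list_of_vec_block[where us = "list_of_vec \<gamma>"])
      (use that N dims in \<open>auto simp: m_def xs_def\<close>)
  have cell_\<gamma>': "m ! ?a' k = \<gamma>' $ (N - 2 - k)" if "k < N - 1" for k
    by (rule nth_list_of_vec_block[where us = "list_of_vec \<gamma> @ list_of_vec r"])
      (use that N dims in \<open>auto simp: m_def xs_def\<close>)
  have cell_r': "m ! ?x' k = r' $ (N - 2 - k)" if "0 < k" "k < N - 1" for k
    by (rule nth_list_of_vec_block[where us = "list_of_vec \<gamma> @ list_of_vec r @ list_of_vec \<gamma>'"])
      (use that N dims in \<open>auto simp: m_def xs_def\<close>)
  have m1: "length m1 = 7 * N - 2 \<and> (\<forall>k\<le>N. m1 ! (5 * N - 3 + k) = v k) \<and>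
    (\<forall>j. j < 5 * N - 3 \<and> j \<noteq> 5 * N - 4 \<or> 5 * N - 3 + N < j \<longrightarrow> m1 ! j = m ! j)"
    unfolding m1_def len_m[symmetric]
  proof (rule fold_recurrence_prog)
    show "v (Suc k) = m ! ?x k * v k + m ! k * m ! ?b k" if "k < N" for k
      unfolding v_def cell_\<gamma>[OF that] cell_y[OF that]
      by (intro L_recurrence[OF A y that] cell_r[OF _ that])
  qed (use N in \<open>auto simp: len_m zero v_def\<close>)
  \<comment> \<open>The first run changes at most the cells from \<open>5 * N - 4\<close> to
    \<open>6 * N - 3\<close>, so the second finds the inputs and its initial zero intact.\<close>
  have m1_input: "m1 ! j = m ! j" if "j < 5 * N - 4 \<or> 6 * N - 2 \<le> j" for j
    using m1 that N by auto
  \<comment> \<open>The scratch cell still holds a product from the first run; this is harmless,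
    since every round begins by overwriting it.\<close>
  have m2: "length m2 = length m1 \<and> (\<forall>k\<le>N - 1. m2 ! (6 * N - 2 + k) = w k) \<and>
    (\<forall>j. j < 6 * N - 2 \<and> j \<noteq> 5 * N - 4 \<or> 6 * N - 2 + (N - 1) < j \<longrightarrow> m2 ! j = m1 ! j)"
    unfolding m2_def
  proof (rule fold_recurrence_prog)
    show "w (Suc k) = m1 ! ?x' k * w k + m1 ! ?a' k * m1 ! ?b' k" if "k < N - 1" for k
    proof -
      have "m1 ! ?x' k = m ! ?x' k" "m1 ! ?a' k = m ! ?a' k"
        using that N by (intro m1_input; linarith)+
      moreover have "m1 ! ?b' k = y $ (N - 1 - k)"
        by (subst m1_input, use that N in linarith) (intro cell_y, use that in linarith)
      ultimately show ?thesis unfolding w_def cell_\<gamma>'[OF that]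
        by (simp only:) (intro U_recurrence[OF B y that] cell_r'[OF _ that])
    qed
    show "w 0 = 0" using U_mult_last[OF B y] N by (simp add: w_def)
    show "m1 ! (6 * N - 2) = 0" using N by (simp add: m1_input zero)
  qed (use N m1 in auto)
  have m3: "m3 ! (5 * N - 2 + k) = m2 ! (5 * N - 2 + k) + m2 ! ?e k" if "k < N" for k
  proof -
    have "5 * N - 2 + N \<le> length m2" using m1 m2 N by linarith
    then show ?thesis using fold_add_prog[of "5 * N - 2" N m2 ?e] that N unfolding m3_def by force
  qed
  have "m3 ! (5 * N - 2 + i) = ((A + B) *\<^sub>v y) $ i" if i: "i < N" for i
  proof -
    \<comment> \<open>The artificial zero row accounts for this shift by one.\<close>
    have "5 * N - 2 + i = 5 * N - 3 + Suc i" using N by linarith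
    moreover have "m1 ! (5 * N - 3 + Suc i) = v (Suc i)" using m1 i by (metis Suc_leI)
    moreover have "m2 ! (5 * N - 2 + i) = m1 ! (5 * N - 2 + i)"
    proof -
      have "5 * N - 2 + i < 6 * N - 2" "5 * N - 2 + i \<noteq> 5 * N - 4" using N i by linarith+
      then show ?thesis using m2 by blast
    qed
    ultimately have "m2 ! (5 * N - 2 + i) = (A *\<^sub>v y) $ i" by (simp only: v_def nat.case)
    moreover have "m2 ! ?e i = w (N - 1 - i)" using m2 by (metis diff_le_self)
    moreover have "w (N - 1 - i) = (B *\<^sub>v y) $ i" using i by (simp add: w_def)
    moreover have "(A + B) *\<^sub>v y = A *\<^sub>v y + B *\<^sub>v y"
      using dims y by (intro add_mult_distrib_mat_vec)
    ultimately show ?thesis using m3[OF i] i dims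
      by (simp only: index_add_vec dim_mult_mat_vec carrier_matD)
  qed
  then have "map (\<lambda>k. m3 ! k) [5 * N - 2..<6 * N - 2] = list_of_vec ((A + B) *\<^sub>v y)"
    using dims N by (intro list_of_vec_eq_mapI[of _ N]) auto
  moreover have "slp_wf (5 * N - 4) (LU_slp N)"
  proof -
    have "addresses I \<subseteq> {..<7 * N - 2}" if "I \<in> set ?p" for I
      using N by (intro addresses_recurrence_prog[OF _ _ _ that]) auto
    moreover have "addresses I \<subseteq> {..<7 * N - 2}" if "I \<in> set ?q" for I
      using N by (intro addresses_recurrence_prog[OF _ _ _ that]) auto
    moreover have "addresses I \<subseteq> {..<7 * N - 2}" if "I \<in> set ?s" for I
      using that N by (auto simp: add_prog_def)
    ultimately show ?thesis using N by (auto simp: slp_wf_def LU_slp_def)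
  qed
  ultimately show ?thesis
    by (simp add: computes_def slp_result_def LU_slp_def len m_def m1_def m2_def m3_def
        flip: xs_def)
qed

section \<open>Linear bounds and the theorem\<close>

text \<open>From \<open>N = 1\<close> on the additive constant is absorbed into the linear term,
  which doubles the factor.\<close>

lemma bigo_real_of_natI:
  assumes "\<And>N. f N \<le> K * N + K"
  shows "(\<lambda>N. real (f N)) \<in> O(\<lambda>N. real N)"
proof (rule bigoI[of _ "2 * real K"])
  have "real (f N) \<le> 2 * real K * real N" if "1 \<le> N" for N
  proof -
    have "K \<le> K * N" using that by simp
    with assms[of N] have "f N \<le> 2 * K * N" by linarith
    then have "real (f N) \<le> real (2 * K * N)" by (simp only: of_nat_le_iff)
    then show ?thesis by simp
  qed
  then show "\<forall>\<^sub>F N in sequentially. norm (real (f N)) \<le> 2 * real K * norm (real N)"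
    by (intro eventually_sequentiallyI[of 1]) simp
qed

theorem mainTheorem1:
  "\<exists>c > 0 :: real.
     (\<exists>P :: nat \<Rightarrow> slp.
        (\<forall>N \<ge> 2. real (arith_ops (P N)) \<le> c * real N \<and>
           (\<forall>\<gamma> r y M. L_specifies N \<gamma> r M \<and> y \<in> carrier_vec N \<longrightarrow>
              computes (P N) [\<gamma>, r, y] (M *\<^sub>v y))) \<and>
        (\<lambda>N. real (storage (P N))) \<in> O(\<lambda>N. real N)) \<and>
     (\<exists>P :: nat \<Rightarrow> slp.
        (\<forall>N \<ge> 2. real (arith_ops (P N)) \<le> c * real N \<and>
           (\<forall>\<gamma> r y M. U_specifies N \<gamma> r M \<and> y \<in> carrier_vec N \<longrightarrow>
              computes (P N) [\<gamma>, r, y] (M *\<^sub>v y))) \<and>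
        (\<lambda>N. real (storage (P N))) \<in> O(\<lambda>N. real N)) \<and>
     (\<exists>P :: nat \<Rightarrow> slp.
        (\<forall>N \<ge> 2.
           (\<forall>\<gamma> r \<gamma>' r' y M\<^sub>L M\<^sub>U M.
              L_specifies N \<gamma> r M\<^sub>L \<and> U_specifies N \<gamma>' r' M\<^sub>U \<and> M = M\<^sub>L + M\<^sub>U \<and>
              y \<in> carrier_vec N \<longrightarrow>
              computes (P N) [\<gamma>, r, \<gamma>', r', y] (M *\<^sub>v y))) \<and>
        (\<lambda>N. real (arith_ops (P N))) \<in> O(\<lambda>N. real N) \<and>
        (\<lambda>N. real (storage (P N))) \<in> O(\<lambda>N. real N))"
\<comment> \<open>A round costs three operations, and there are \<open>N\<close> rounds for the
  lower and \<open>N - 1\<close> for the upper matrix, whence \<open>3\<close>.\<close>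
proof (intro exI[of _ "3 :: real"] conjI)
  show "\<exists>P. (\<forall>N \<ge> 2. real (arith_ops (P N)) \<le> 3 * real N \<and>
           (\<forall>\<gamma> r y M. L_specifies N \<gamma> r M \<and> y \<in> carrier_vec N \<longrightarrow>
              computes (P N) [\<gamma>, r, y] (M *\<^sub>v y))) \<and>
        (\<lambda>N. real (storage (P N))) \<in> O(\<lambda>N. real N)"
    using computes_L_slp
    by (intro exI[of _ L_slp] conjI bigo_real_of_natI[of _ 4])
      (auto simp: L_slp_def arith_ops_def)
  show "\<exists>P. (\<forall>N \<ge> 2. real (arith_ops (P N)) \<le> 3 * real N \<and>
           (\<forall>\<gamma> r y M. U_specifies N \<gamma> r M \<and> y \<in> carrier_vec N \<longrightarrow>
              computes (P N) [\<gamma>, r, y] (M *\<^sub>v y))) \<and>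
        (\<lambda>N. real (storage (P N))) \<in> O(\<lambda>N. real N)"
    using computes_U_slp
    by (intro exI[of _ U_slp] conjI bigo_real_of_natI[of _ 4])
      (auto simp: U_slp_def arith_ops_def)
  show "\<exists>P. (\<forall>N \<ge> 2.
           (\<forall>\<gamma> r \<gamma>' r' y M\<^sub>L M\<^sub>U M.
              L_specifies N \<gamma> r M\<^sub>L \<and> U_specifies N \<gamma>' r' M\<^sub>U \<and> M = M\<^sub>L + M\<^sub>U \<and>
              y \<in> carrier_vec N \<longrightarrow>
              computes (P N) [\<gamma>, r, \<gamma>', r', y] (M *\<^sub>v y))) \<and>
        (\<lambda>N. real (arith_ops (P N))) \<in> O(\<lambda>N. real N) \<and>
        (\<lambda>N. real (storage (P N))) \<in> O(\<lambda>N. real N)"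
    \<comment> \<open>For \<open>N \<ge> 1\<close> the combined program has
      \<open>3 * N + 3 * (N - 1) + N\<close> operations and \<open>7 * N - 2\<close> cells, so
      \<open>7\<close> serves for both bounds.\<close>
    using computes_LU_slp
    by (intro exI[of _ LU_slp] conjI bigo_real_of_natI[of _ 7])
      (auto simp: LU_slp_def arith_ops_def add_prog_def)
qed simp

end
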